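(* Let $\Phi(a,b)$ be the $6\times 6$ array of vectors in $\mathbb{C}^6$, depending on real $a,b>0$ with $a^2+b^2=1$, defined in the context. Then the array $\Phi_{25}=\Phi\left(\frac45,\frac35\right)$ is a quantum Latin square of order $6$ and its cardinality is $25$.
   Context: A quantum Latin square of order $n$, denoted $\mathrm{QLS}(n)$, is an $n\times n$ array of unit vectors in $\mathbb{C}^n$ such that every row and every column forms an orthonormal basis of $\mathbb{C}^n$. Two unit vectors $u,v$ are phase equivalent if $u=e^{i\alpha}v$ for some $\alpha\in\mathbb{R}$. The cardinality of a quantum Latin square is the number of distinct phase-equivalence classes among its $n^2$ entries. Let $e_0,\dots,e_5$ be the standard basis of $\mathbb{C}^6=\mathcal U\oplus\mathcal V$, where $\mathcal U=\operatorname{span}\{e_0,e_1,e_2,e_3\}$ and $\mathcal V=\operatorname{span}\{e_4,e_5\}$. Let $\rho=1/\sqrt2$, and let $a,b>0$ be real with $a^2+b^2=1$. A $4$-tuple $(t_0,t_1,t_2,t_3)$ denotes the vector $t_0e_0+t_1e_1+t_2e_2+t_3e_3\in\mathcal U$. Define the following vectors of $\mathcal U$: $A=(1,0,0,0)$, $B=(0,1,0,0)$, $C=(0,0,1,0)$, $D=(0,0,0,1)$, $E=(0,a,b\rho,b\rho)$, $F=(a,0,b\rho,-b\rho)$, $G=(b\rho,-b\rho,0,a)$, $H=(-b\rho,-b\rho,a,0)$, $I=(0,-b,a\rho,a\rho)$, $J=(-b,0,a\rho,-a\rho)$, $K=(-a\rho,a\rho,0,b)$, $L=(a\rho,a\rho,b,0)$,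 $M=(-a\rho,a\rho,b,0)$, $N=(b\rho,-b\rho,a,0)$, $O=(\rho,\rho,0,0)$, $P=(a\rho,a\rho,0,b)$, $Q=(-b\rho,-b\rho,0,a)$, $R=(-\rho,\rho,0,0)$, $S=(0,0,\rho,\rho)$, $T=(b,0,a\rho,-a\rho)$, $U=(-a,0,b\rho,-b\rho)$. Define in $\mathcal V$: $x=e_4$, $y=e_5$, $z=\rho(e_4+e_5)$, $w=\rho(e_4-e_5)$. Set $$\Phi(a,b)=\begin{pmatrix} x & A & y & B & C & D \\ y & x & E & F & G & H \\ I & y & x & J & K & L \\ M & D & N & z & O & w \\ P & C & Q & w & z & R \\ T & B & U & S & w & z \end{pmatrix}.$$ *)

theory Defs
  imports Complex_Main "Jordan_Normal_Form.Gram_Schmidt" "Jordan_Normal_Form.VS_Connect"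
begin

definition unit_vectors :: "nat \<Rightarrow> complex vec set" where
  "unit_vectors n = {v \<in> carrier_vec n. v \<bullet>c v = 1}"

text \<open>A list (rather than a set) of vectors, so that repeated entries are excluded by orthogonality.\<close>

definition orthonormal_basis :: "nat \<Rightarrow> complex vec list \<Rightarrow> bool" where
  "orthonormal_basis n vs \<longleftrightarrow>
     set vs \<subseteq> unit_vectors n \<and>
     (\<forall>i < length vs. \<forall>j < length vs. i \<noteq> j \<longrightarrow> vs ! i \<bullet>c vs ! j = 0) \<and>
     vectorspace.basis class_ring (module_vec TYPE(complex) n) (set vs)"

text \<open>The array is a matrix whose entries are themselves vectors.\<close>

definition quantum_latin_square :: "nat \<Rightarrow> complex vec mat \<Rightarrow> bool" where
  "quantum_latin_square n X \<longleftrightarrow>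
     X \<in> carrier_mat n n \<and>
     elements_mat X \<subseteq> unit_vectors n \<and>
     (\<forall>i < n. orthonormal_basis n (list_of_vec (row X i))) \<and>
     (\<forall>j < n. orthonormal_basis n (list_of_vec (col X j)))"

definition phase_equiv :: "nat \<Rightarrow> (complex vec \<times> complex vec) set" where
  "phase_equiv n = {(u, v). u \<in> unit_vectors n \<and> v \<in> unit_vectors n \<and>
     (\<exists>\<alpha>::real. u = exp (\<i> * complex_of_real \<alpha>) \<cdot>\<^sub>v v)}"

lemma equiv_phase_equiv: "equiv (unit_vectors n) (phase_equiv n)"
proof (rule equivI)
  show "phase_equiv n \<subseteq> unit_vectors n \<times> unit_vectors n"
    by (auto simp: phase_equiv_def)
  show "refl_on (unit_vectors n) (phase_equiv n)"
    by (auto simp: refl_on_def phase_equiv_def intro!: exI[of _ 0])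
  show "sym (phase_equiv n)"
  proof (rule symI)
    fix u v assume "(u, v) \<in> phase_equiv n"
    then obtain \<alpha> :: real where *: "u \<in> unit_vectors n" "v \<in> unit_vectors n"
      "u = exp (\<i> * complex_of_real \<alpha>) \<cdot>\<^sub>v v" by (auto simp: phase_equiv_def)
    have "v = exp (\<i> * complex_of_real (- \<alpha>)) \<cdot>\<^sub>v u"
      unfolding *(3) by (simp add: smult_smult_assoc flip: exp_add)
    with *(1,2) show "(v, u) \<in> phase_equiv n" unfolding phase_equiv_def by blast
  qed
  show "trans (phase_equiv n)"
  proof (rule transI)
    fix u v w assume "(u, v) \<in> phase_equiv n" "(v, w) \<in> phase_equiv n"
    then obtain \<alpha> \<beta> :: real where *: "u \<in> unit_vectors n" "w \<in> unit_vectors n"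
      "u = exp (\<i> * complex_of_real \<alpha>) \<cdot>\<^sub>v v" "v = exp (\<i> * complex_of_real \<beta>) \<cdot>\<^sub>v w"
      by (auto simp: phase_equiv_def)
    have "u = exp (\<i> * complex_of_real (\<alpha> + \<beta>)) \<cdot>\<^sub>v w"
      unfolding *(3,4) by (simp add: smult_smult_assoc distrib_left flip: exp_add)
    with *(1,2) show "(u, w) \<in> phase_equiv n" unfolding phase_equiv_def by blast
  qed
qed

definition qls_cardinality :: "nat \<Rightarrow> complex vec mat \<Rightarrow> nat" where
  "qls_cardinality n X = card (elements_mat X // phase_equiv n)"

definition tup :: "real \<Rightarrow> real \<Rightarrow> real \<Rightarrow> real \<Rightarrow> complex vec" where
  "tup t0 t1 t2 t3 =
     complex_of_real t0 \<cdot>\<^sub>v unit_vec 6 0 + complex_of_real t1 \<cdot>\<^sub>v unit_vec 6 1 +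
     complex_of_real t2 \<cdot>\<^sub>v unit_vec 6 2 + complex_of_real t3 \<cdot>\<^sub>v unit_vec 6 3"

text \<open>The name \<open>O'\<close> is primed only because \<open>O\<close> is the infix symbol for relation composition.\<close>

definition Phi :: "real \<Rightarrow> real \<Rightarrow> complex vec mat" where
  "Phi a b = (let
     \<rho> = 1 / sqrt 2;
     A = tup 1 0 0 0;
     B = tup 0 1 0 0;
     C = tup 0 0 1 0;
     D = tup 0 0 0 1;
     E = tup 0 a (b*\<rho>) (b*\<rho>);
     F = tup a 0 (b*\<rho>) (-b*\<rho>);
     G = tup (b*\<rho>) (-b*\<rho>) 0 a;
     H = tup (-b*\<rho>) (-b*\<rho>) a 0;
     I = tup 0 (-b) (a*\<rho>) (a*\<rho>);
     J = tup (-b) 0 (a*\<rho>) (-a*\<rho>);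
     K = tup (-a*\<rho>) (a*\<rho>) 0 b;
     L = tup (a*\<rho>) (a*\<rho>) b 0;
     M = tup (-a*\<rho>) (a*\<rho>) b 0;
     N = tup (b*\<rho>) (-b*\<rho>) a 0;
     O' = tup \<rho> \<rho> 0 0;
     P = tup (a*\<rho>) (a*\<rho>) 0 b;
     Q = tup (-b*\<rho>) (-b*\<rho>) 0 a;
     R = tup (-\<rho>) \<rho> 0 0;
     S = tup 0 0 \<rho> \<rho>;
     T = tup b 0 (a*\<rho>) (-a*\<rho>);
     U = tup (-a) 0 (b*\<rho>) (-b*\<rho>);
     x = unit_vec 6 4;
     y = unit_vec 6 5;
     z = complex_of_real \<rho> \<cdot>\<^sub>v (unit_vec 6 4 + unit_vec 6 5);
     w = complex_of_real \<rho> \<cdot>\<^sub>v (unit_vec 6 4 - unit_vec 6 5)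
   in mat_of_rows_list 6
     [[x, A, y, B, C, D],
      [y, x, E, F, G, H],
      [I, y, x, J, K, L],
      [M, D, N, z, O', w],
      [P, C, Q, w, z, R],
      [T, B, U, S, w, z]])"

end

theory Submission
  imports Defs
begin

text \<open>
  Multiplied by \<open>10\<close>, the coordinates of all entries of \<open>\<Phi>(4/5, 3/5)\<close> lie in \<open>\<int>[\<surd>2]\<close>, so
  orthonormality of the rows and columns is a computation with integers. Phase equivalent vectors
  \<open>u\<close>, \<open>v\<close> satisfy \<open>u\<^sub>i v\<^sub>j = u\<^sub>j v\<^sub>i\<close>; taking integer norms \<open>p\<^sup>2 - 2 q\<^sup>2\<close> of the differences shows
  that this fails for any two of the \<open>25\<close> distinct entries.
\<close>

section \<open>Orthonormal families and quotients\<close>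

text \<open>Orthonormality makes the Gram matrix, the product of \<open>M\<close> with its conjugate
  transpose, the identity. Hence \<open>det M\<close> is nonzero, the rows are independent, and
  \<open>n\<close> independent vectors in dimension \<open>n\<close> form a basis.\<close>

lemma orthonormal_basisI:
  assumes len: "length vs = n" and carrier: "set vs \<subseteq> carrier_vec n"
    and orth: "\<And>i j. i < n \<Longrightarrow> j < n \<Longrightarrow> vs ! i \<bullet>c vs ! j = (if i = j then 1 else 0)"
  shows "orthonormal_basis n vs"
proof -
  interpret vec_space "TYPE(complex)" n .
  define M where "M = mat_of_rows n vs"
  have M: "M \<in> carrier_mat n n" using mat_of_rows_carrier(1)[of n vs] by (simp add: M_def len)
  have rows: "rows M = vs" unfolding M_def using carrier by simp
  have row: "row M i = vs ! i" if "i < n" for i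
    using that len carrier unfolding M_def by (metis mat_of_rows_row nth_mem subsetD)
  have "M * transpose_mat (map_mat conjugate M) = 1\<^sub>m n"
  proof (rule eq_matI)
    fix i j assume ij: "i < dim_row (1\<^sub>m n :: complex mat)" "j < dim_col (1\<^sub>m n :: complex mat)"
    have "col (transpose_mat (map_mat conjugate M)) j = conjugate (vs ! j)"
      using ij M by (auto simp flip: row)
    then show "(M * transpose_mat (map_mat conjugate M)) $$ (i, j) = 1\<^sub>m n $$ (i, j)"
      using ij M by (simp add: row orth)
  qed (use M in auto)
  then have "det M * det (transpose_mat (map_mat conjugate M)) = 1"
    using M by (subst det_mult[symmetric, of _ n]) auto
  then have "det M \<noteq> 0" by auto
  from det_not_0_imp_lin_indpt_rows[OF M this] have li: "lin_indpt (set vs)" by (simp add: rows)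
  \<comment> \<open>Independence of \<open>set vs\<close> says nothing about repetitions in the
    list; orthogonality excludes them, so the set has exactly \<open>n\<close> elements.\<close>
  have "corthogonal vs"
    by (rule corthogonalI) (auto simp: len orth)
  then have "card (set vs) = n"
    using corthogonal_distinct distinct_card len by blast
  then have "basis (set vs)"
    using li carrier by (intro dim_li_is_basis) (auto simp: dim_is_n)
  moreover have "set vs \<subseteq> unit_vectors n"
    using carrier by (auto simp: unit_vectors_def in_set_conv_nth len orth)
  ultimately show ?thesis by (simp add: orthonormal_basis_def len orth)
qed

text \<open>By \<open>inj\<close>, sending \<open>x\<close> to the class of \<open>f x\<close> is
  injective on \<open>A\<close>. This lets classes of vectors be counted through their
  encodings.\<close>

lemma card_quotient_image:
  assumes "equiv S r" "f ` A \<subseteq> S" and inj: "\<And>x y. x \<in> A \<Longrightarrow> y \<in> A \<Longrightarrow> (f x, f y) \<in> r \<Longrightarrow> x = y"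
  shows "card ((f ` A) // r) = card A"
proof -
  have "(f ` A) // r = (\<lambda>x. r `` {f x}) ` A" by (auto simp: quotient_def)
  moreover have "inj_on (\<lambda>x. r `` {f x}) A"
    using assms(1,2) by (intro inj_onI inj) (auto simp: image_subset_iff dest: eq_equiv_class)
  ultimately show ?thesis by (simp add: card_image)
qed

text \<open>If \<open>u\<close> is \<open>c\<close> times \<open>v\<close>, both sides are
  \<open>c * v $ i * v $ j\<close>; the condition no longer mentions the phase.\<close>

lemma phase_equiv_minors:
  assumes "(u, v) \<in> phase_equiv n" "i < n" "j < n"
  shows "u $ i * v $ j = u $ j * v $ i"
  using assms by (auto simp: phase_equiv_def unit_vectors_def)

section \<open>Exact coordinates\<close>

text \<open>The pair \<open>(p, q)\<close> encodes \<open>(p + q \<surd>2) / 10\<close>.\<close>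

definition val :: "int \<times> int \<Rightarrow> complex" where
  "val x = complex_of_real ((real_of_int (fst x) + real_of_int (snd x) * sqrt 2) / 10)"

fun mult2 :: "int \<times> int \<Rightarrow> int \<times> int \<Rightarrow> int \<times> int" where
  "mult2 (p, q) (p', q') = (p * p' + 2 * q * q', p * q' + q * p')"

definition dot2 :: "(int \<times> int) list \<Rightarrow> (int \<times> int) list \<Rightarrow> int \<times> int" where
  "dot2 xs ys = (let zs = map2 mult2 xs ys in (sum_list (map fst zs), sum_list (map snd zs)))"

definition vec2 :: "(int \<times> int) list \<Rightarrow> complex vec" where
  "vec2 xs = vec_of_list (map val xs)"

text \<open>The product has denominator 100, of which \<open>val\<close> absorbs only one factor
  10.\<close>

lemma val_mult: "val x * val y = val (mult2 x y) / 10"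
proof -
  let ?r = "\<lambda>x. (real_of_int (fst x) + real_of_int (snd x) * sqrt 2) / 10"
  have "sqrt 2 * (sqrt 2 * a) = 2 * a" for a :: real by (simp flip: mult.assoc)
  then have "?r x * ?r y = ?r (mult2 x y) / 10"
    by (cases x; cases y) (simp add: field_simps)
  from arg_cong[OF this, of complex_of_real] show ?thesis
    by (simp only: val_def of_real_mult) simp
qed

lemma cnj_val [simp]: "cnj (val x) = val x"
  by (simp add: val_def)

lemma val_add: "val x + val y = val (fst x + fst y, snd x + snd y)"
  by (simp add: val_def field_simps)

text \<open>Isolating \<open>sqrt 2\<close> and squaring leaves an identity of integers, whose
  failure certifies that two values differ.\<close>

lemma val_eq_imp_norm_eq:
  assumes "val x = val y"
  shows "(fst x - fst y)\<^sup>2 = 2 * (snd x - snd y)\<^sup>2"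
proof -
  have "real_of_int (fst x) + real_of_int (snd x) * sqrt 2
      = real_of_int (fst y) + real_of_int (snd y) * sqrt 2"
    using assms unfolding val_def of_real_eq_iff by simp
  then have "real_of_int (fst x - fst y) = - real_of_int (snd x - snd y) * sqrt 2"
    by (simp add: algebra_simps)
  then have "(real_of_int (fst x - fst y))\<^sup>2 = 2 * (real_of_int (snd x - snd y))\<^sup>2"
    by (simp add: power_mult_distrib del: of_int_diff)
  then have "real_of_int ((fst x - fst y)\<^sup>2) = real_of_int (2 * (snd x - snd y)\<^sup>2)"
    by simp
  then show ?thesis by (simp only: of_int_eq_iff)
qed

lemma vec2_carrier: "length xs = n \<Longrightarrow> vec2 xs \<in> carrier_vec n"
  by (auto simp: vec2_def intro!: carrier_vecI)

lemma vec2_index: "i < length xs \<Longrightarrow> vec2 xs $ i = val (xs ! i)"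
  by (simp add: vec2_def vec_of_list_index)

lemma vec2_scalar_prod:
  assumes "length xs = length ys"
  shows "vec2 xs \<bullet>c vec2 ys = val (dot2 xs ys) / 10"
proof -
  have "vec2 xs \<bullet>c vec2 ys = (\<Sum>i<length ys. val (xs ! i) * val (ys ! i))"
    using assms by (auto simp: scalar_prod_def vec2_index vec2_def atLeast0LessThan vec_of_list_index)
  also have "\<dots> = val (dot2 xs ys) / 10"
    using assms
  proof (induction xs ys rule: list_induct2)
    case Nil
    then show ?case by (simp add: dot2_def val_def)
  next
    case (Cons x xs y ys)
    then show ?case
      \<comment> \<open>The first summand is split off instead of the last, to match the heads of
        the two lists.\<close>
      by (simp add: sum.lessThan_Suc_shift dot2_def Let_def val_mult val_add del: sum.lessThan_Suc
          flip: add_divide_distrib)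
  qed
  finally show ?thesis .
qed

text \<open>The Gram matrix is \<open>100\<close> times the identity because each vector carries a factor \<open>10\<close>.\<close>

definition orthonormal2 :: "(int \<times> int) list list \<Rightarrow> bool" where
  "orthonormal2 xss \<longleftrightarrow> list_all (\<lambda>xs. length xs = length xss) xss \<and>
     list_all (\<lambda>i. list_all (\<lambda>j. dot2 (xss ! i) (xss ! j) = (if i = j then (100, 0) else (0, 0)))
       [0..<length xss]) [0..<length xss]"

lemma orthonormal2_imp_basis:
  assumes "orthonormal2 xss" "length xss = n"
  shows "orthonormal_basis n (map vec2 xss)"
proof (rule orthonormal_basisI)
  have len: "length xs = n" if "xs \<in> set xss" for xs
    using assms that by (auto simp: orthonormal2_def list_all_iff)
  then show "set (map vec2 xss) \<subseteq> carrier_vec n"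
    by (auto intro: vec2_carrier)
  fix i j assume ij: "i < n" "j < n"
  then have "dot2 (xss ! i) (xss ! j) = (if i = j then (100, 0) else (0, 0))"
    using assms by (auto simp: orthonormal2_def list_all_iff)
  moreover have "length (xss ! i) = length (xss ! j)"
    using ij assms(2) by (simp add: len)
  \<comment> \<open>\<open>(100, 0)\<close> has value 10 under \<open>val\<close>; the factor 1/10
    in \<open>vec2_scalar_prod\<close> turns it into 1.\<close>
  ultimately show "map vec2 xss ! i \<bullet>c map vec2 xss ! j = (if i = j then 1 else 0)"
    using ij assms(2) by (simp add: vec2_scalar_prod val_def)
qed (use assms in auto)

text \<open>An executable certificate that some 2 by 2 minor of the matrix with rows
  \<open>xs\<close> and \<open>ys\<close> is nonzero.\<close>

definition nonproportional2 :: "nat \<Rightarrow> (int \<times> int) list \<Rightarrow> (int \<times> int) list \<Rightarrow> bool" where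
  "nonproportional2 n xs ys \<longleftrightarrow> list_ex (\<lambda>i. list_ex (\<lambda>j.
     let x = mult2 (xs ! i) (ys ! j); y = mult2 (xs ! j) (ys ! i)
     in (fst x - fst y)\<^sup>2 \<noteq> 2 * (snd x - snd y)\<^sup>2) [0..<n]) [0..<n]"

lemma nonproportional2_imp_not_phase_equiv:
  assumes "nonproportional2 n xs ys" "length xs = n" "length ys = n"
  shows "(vec2 xs, vec2 ys) \<notin> phase_equiv n"
proof
  assume *: "(vec2 xs, vec2 ys) \<in> phase_equiv n"
  from assms(1) obtain i j where ij: "i < n" "j < n"
    and ne: "(fst (mult2 (xs ! i) (ys ! j)) - fst (mult2 (xs ! j) (ys ! i)))\<^sup>2
      \<noteq> 2 * (snd (mult2 (xs ! i) (ys ! j)) - snd (mult2 (xs ! j) (ys ! i)))\<^sup>2"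
    by (auto simp: nonproportional2_def list_ex_iff Let_def)
  from phase_equiv_minors[OF * ij] have "val (mult2 (xs ! i) (ys ! j)) = val (mult2 (xs ! j) (ys ! i))"
    using ij assms by (simp add: vec2_index val_mult)
  with ne val_eq_imp_norm_eq show False by blast
qed

section \<open>The array\<close>

text \<open>For a = 4/5 and b = 3/5, ten times a, b, \<rho>, a\<rho>, b\<rho> is 8, 6, 5 sqrt 2, 4
  sqrt 2, 3 sqrt 2. Here \<open>c\<close> encodes integers and \<open>r\<close> multiples of
  \<open>sqrt 2\<close>.\<close>

definition Phi25 :: "(int \<times> int) list list list" where
  "Phi25 = (let
     c = (\<lambda>k. (k, 0));
     r = (\<lambda>k. (0, k));
     t = (\<lambda>t0 t1 t2 t3. [t0, t1, t2, t3, (0, 0), (0, 0)]);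
     v = (\<lambda>t4 t5. [(0, 0), (0, 0), (0, 0), (0, 0), t4, t5]);
     A = t (c 10) (c 0) (c 0) (c 0);
     B = t (c 0) (c 10) (c 0) (c 0);
     C = t (c 0) (c 0) (c 10) (c 0);
     D = t (c 0) (c 0) (c 0) (c 10);
     E = t (c 0) (c 8) (r 3) (r 3);
     F = t (c 8) (c 0) (r 3) (r (- 3));
     G = t (r 3) (r (- 3)) (c 0) (c 8);
     H = t (r (- 3)) (r (- 3)) (c 8) (c 0);
     I = t (c 0) (c (- 6)) (r 4) (r 4);
     J = t (c (- 6)) (c 0) (r 4) (r (- 4));
     K = t (r (- 4)) (r 4) (c 0) (c 6);
     L = t (r 4) (r 4) (c 6) (c 0);
     M = t (r (- 4)) (r 4) (c 6) (c 0);
     N = t (r 3) (r (- 3)) (c 8) (c 0);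
     O' = t (r 5) (r 5) (c 0) (c 0);
     P = t (r 4) (r 4) (c 0) (c 6);
     Q = t (r (- 3)) (r (- 3)) (c 0) (c 8);
     R = t (r (- 5)) (r 5) (c 0) (c 0);
     S = t (c 0) (c 0) (r 5) (r 5);
     T = t (c 6) (c 0) (r 4) (r (- 4));
     U = t (c (- 8)) (c 0) (r 3) (r (- 3));
     x = v (c 10) (c 0);
     y = v (c 0) (c 10);
     z = v (r 5) (r 5);
     w = v (r 5) (r (- 5))
   in
     [[x, A, y, B, C, D],
      [y, x, E, F, G, H],
      [I, y, x, J, K, L],
      [M, D, N, z, O', w],
      [P, C, Q, w, z, R],
      [T, B, U, S, w, z]])"

lemma tup_conv_vec_of_list:
  "tup t0 t1 t2 t3 = vec_of_list (map complex_of_real [t0, t1, t2, t3, 0, 0])"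
  by (rule eq_vecI) (auto simp: tup_def unit_vec_def less_Suc_eq numeral_eq_Suc)

lemma unit_vec_6_conv_vec_of_list:
  "unit_vec 6 4 = vec_of_list [0, 0, 0, 0, 1, 0 :: complex]"
  "unit_vec 6 5 = vec_of_list [0, 0, 0, 0, 0, 1 :: complex]"
  by (rule eq_vecI; auto simp: unit_vec_def less_Suc_eq numeral_eq_Suc)+

text \<open>These rules let the simplifier evaluate the sums defining \<open>z\<close> and
  \<open>w\<close> coordinate by coordinate.\<close>

lemma vec_Cons_algebra:
  fixes a b k :: "'a :: ring"
  shows "vNil + vNil = (vNil :: 'a vec)"
    and "k \<cdot>\<^sub>v vNil = vNil"
    and "vCons a v + vCons b w = vCons (a + b) (v + w)"
    and "vCons a v - vCons b w = vCons (a - b) (v - w)"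
    and "k \<cdot>\<^sub>v vCons a v = vCons (k * a) (k \<cdot>\<^sub>v v)"
  by (rule eq_vecI; auto simp: vec_index_vCons less_Suc_eq_0_disj)+

lemma Phi_conv_Phi25: "Phi (4/5) (3/5) = mat_of_rows_list 6 (map (map vec2) Phi25)"
proof -
  \<comment> \<open>Rationalising the denominator brings every coordinate into the form used by
    \<open>val\<close>.\<close>
  have inv_sqrt2: "1 / sqrt 2 = sqrt 2 / 2"
    by (simp add: field_simps)
  show ?thesis
    unfolding Phi_def Phi25_def Let_def unit_vec_6_conv_vec_of_list tup_conv_vec_of_list inv_sqrt2
    by (simp add: vec2_def val_def vec_Cons_algebra)
qed

lemma Phi25_dims: "length Phi25 = 6" "xss \<in> set Phi25 \<Longrightarrow> length xss = 6"
  "xss \<in> set Phi25 \<Longrightarrow> xs \<in> set xss \<Longrightarrow> length xs = 6"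
  by (auto simp: Phi25_def Let_def)

lemma Phi25_rows: "list_all orthonormal2 Phi25"
  by code_simp

lemma Phi25_cols: "list_all (\<lambda>j. orthonormal2 (map (\<lambda>xss. xss ! j) Phi25)) [0..<6]"
  by code_simp

lemma Phi25_pairs:
  "list_all (\<lambda>xs. list_all (\<lambda>ys. xs = ys \<or> nonproportional2 6 xs ys) (remdups (concat Phi25)))
     (remdups (concat Phi25))"
  by code_simp

text \<open>Among the 36 positions, \<open>x\<close>, \<open>y\<close>, \<open>z\<close>,
  \<open>w\<close> occur three times and \<open>B\<close>, \<open>C\<close>, \<open>D\<close> twice,
  leaving 36 - 8 - 3 = 25 lists.\<close>

lemma Phi25_card: "length (remdups (concat Phi25)) = 25"
  by code_simp

lemma elements_mat_of_rows_list:
  assumes "\<And>xss. xss \<in> set X \<Longrightarrow> length xss = n"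
  shows "elements_mat (mat_of_rows_list n X) = set (concat X)"
proof -
  have "elements_mat (mat_of_rows_list n X) = {X ! i ! j | i j. i < length X \<and> j < n}"
    by (fastforce simp: elements_mat_def mat_of_rows_list_def)
  also have "\<dots> = set (concat X)"
    using assms by (fastforce simp: in_set_conv_nth)
  finally show ?thesis .
qed

lemma quantum_latin_square_mat_of_rows_list:
  assumes len: "length X = n" and wf: "\<And>xss. xss \<in> set X \<Longrightarrow> length xss = n"
    and rows: "\<And>xss. xss \<in> set X \<Longrightarrow> orthonormal_basis n xss"
    and cols: "\<And>j. j < n \<Longrightarrow> orthonormal_basis n (map (\<lambda>xss. xss ! j) X)"
  shows "quantum_latin_square n (mat_of_rows_list n X)"
proof -
  let ?X = "mat_of_rows_list n X"
  have row: "list_of_vec (row ?X i) = X ! i" if "i < n" for i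
    using that len wf by (intro nth_equalityI) (auto simp: mat_of_rows_list_def)
  have col: "list_of_vec (col ?X j) = map (\<lambda>xss. xss ! j) X" if "j < n" for j
    using that len by (intro nth_equalityI) (auto simp: mat_of_rows_list_def)
  \<comment> \<open>Every entry lies in some row, and the rows consist of unit vectors.\<close>
  have "elements_mat ?X \<subseteq> unit_vectors n"
    using rows wf by (auto simp: elements_mat_of_rows_list orthonormal_basis_def)
  then show ?thesis
    using len rows cols
    by (auto simp: quantum_latin_square_def row col) (auto simp: mat_of_rows_list_def)
qed

theorem theorem4:
  shows "quantum_latin_square 6 (Phi (4/5) (3/5)) \<and> qls_cardinality 6 (Phi (4/5) (3/5)) = 25"
proof
  let ?X = "map (map vec2) Phi25"
  show qls: "quantum_latin_square 6 (Phi (4/5) (3/5))"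
    unfolding Phi_conv_Phi25
  proof (rule quantum_latin_square_mat_of_rows_list)
    show "length ?X = 6" by (simp add: Phi25_dims)
    show "length xss = 6" if "xss \<in> set ?X" for xss
      using that by (auto simp: Phi25_dims)
    show "orthonormal_basis 6 xss" if "xss \<in> set ?X" for xss
      using that Phi25_rows by (auto simp: list_all_iff Phi25_dims intro!: orthonormal2_imp_basis)
    show "orthonormal_basis 6 (map (\<lambda>xss. xss ! j) ?X)" if "j < 6" for j
    proof -
      have "map (\<lambda>xss. xss ! j) ?X = map vec2 (map (\<lambda>xss. xss ! j) Phi25)"
        using that by (simp add: Phi25_dims)
      moreover have "orthonormal2 (map (\<lambda>xss. xss ! j) Phi25)"
        using that Phi25_cols by (auto simp: list_all_iff)
      ultimately show ?thesis
        using orthonormal2_imp_basis by (metis Phi25_dims(1) length_map)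
    qed
  qed
  have elements: "elements_mat (Phi (4/5) (3/5)) = vec2 ` set (concat Phi25)"
    unfolding Phi_conv_Phi25 by (subst elements_mat_of_rows_list) (auto simp: Phi25_dims)
  \<comment> \<open>Distinct encodings give inequivalent vectors, so counting phase classes reduces
    to counting lists.\<close>
  have "card ((vec2 ` set (concat Phi25)) // phase_equiv 6) = card (set (concat Phi25))"
  proof (rule card_quotient_image[OF equiv_phase_equiv])
    show "vec2 ` set (concat Phi25) \<subseteq> unit_vectors 6"
      using qls elements by (simp add: quantum_latin_square_def)
    fix xs ys
    assume xs: "xs \<in> set (concat Phi25)" and ys: "ys \<in> set (concat Phi25)"
      and equiv: "(vec2 xs, vec2 ys) \<in> phase_equiv 6"
    from xs ys have "length xs = 6" "length ys = 6" by (auto simp: Phi25_dims)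
    with equiv have "\<not> nonproportional2 6 xs ys"
      using nonproportional2_imp_not_phase_equiv by blast
    moreover have "xs = ys \<or> nonproportional2 6 xs ys"
      using Phi25_pairs xs ys unfolding list_all_iff set_remdups by blast
    ultimately show "xs = ys" by blast
  qed
  also have "\<dots> = 25"
    using Phi25_card by (simp only: length_remdups_card_conv)
  finally show "qls_cardinality 6 (Phi (4/5) (3/5)) = 25"
    by (simp add: qls_cardinality_def elements)
qed

end
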